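(* Let $G$ be a finitely generated, virtually nilpotent group (equivalently, a finitely generated group of polynomial growth), and let $X$ be a finite generating set of $G$. Then $\mathrm{cr}_X(G)>0$ if and only if $G$ is virtually abelian.
   Context: For a group $G$ with finite generating set $X$, $\mathbb{B}_{G,X}(n)$ is the ball of radius $n$ about the identity for the word length over $X\cup X^{-1}$, and $C_{G,X}(n)$ is the set of conjugacy classes of $G$ having a representative in $\mathbb{B}_{G,X}(n)$. The conjugacy ratio is $\mathrm{cr}_X(G)=\limsup_{n\to\infty}\frac{|C_{G,X}(n)|}{|\mathbb{B}_{G,X}(n)|}$. Polynomial growth means that $|\mathbb{B}_{G,X}(n)|$ is bounded above by a polynomial function of $n$; the equivalence with being virtually nilpotent is the known theorem of Gromov (together with its known converse). *)

theory Defs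
  imports "HOL-Algebra.Algebra" "HOL-Library.Extended_Real"
begin

definition symm_gens :: "('a, 'b) monoid_scheme \<Rightarrow> 'a set \<Rightarrow> 'a set" where
  "symm_gens G S = S \<union> m_inv G ` S"

definition word_prod :: "('a, 'b) monoid_scheme \<Rightarrow> 'a list \<Rightarrow> 'a" where
  "word_prod G ws = foldr (\<lambda>x y. x \<otimes>\<^bsub>G\<^esub> y) ws \<one>\<^bsub>G\<^esub>"

text \<open>The word length is only meaningful for elements of \<^term>\<open>generate G S\<close>;
  elsewhere the \<^term>\<open>Least\<close> below ranges over the empty set and is unspecified, which is why
  the ball is cut out of \<^term>\<open>generate G S\<close>.\<close>

definition word_length :: "('a, 'b) monoid_scheme \<Rightarrow> 'a set \<Rightarrow> 'a \<Rightarrow> nat" where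
  "word_length G S g =
     (LEAST k. \<exists>ws \<in> lists (symm_gens G S). length ws = k \<and> word_prod G ws = g)"

definition word_ball :: "('a, 'b) monoid_scheme \<Rightarrow> 'a set \<Rightarrow> nat \<Rightarrow> 'a set" where
  "word_ball G S n = {g \<in> generate G S. word_length G S g \<le> n}"

text \<open>The restricted abstraction is the form in which the library states that conjugation is a
  group action (\<open>action_by_conjugation\<close>).\<close>

definition conj_classes :: "('a, 'b) monoid_scheme \<Rightarrow> 'a set set" where
  "conj_classes G = orbits G (carrier G)
     (\<lambda>g. \<lambda>h \<in> carrier G. g \<otimes>\<^bsub>G\<^esub> h \<otimes>\<^bsub>G\<^esub> inv\<^bsub>G\<^esub> g)"

definition conj_classes_ball :: "('a, 'b) monoid_scheme \<Rightarrow> 'a set \<Rightarrow> nat \<Rightarrow> 'a set set" where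
  "conj_classes_ball G S n = {K \<in> conj_classes G. K \<inter> word_ball G S n \<noteq> {}}"

text \<open>The upper limit is taken in the extended reals, where it always exists. For a finite
  generating set the quotients are ratios of genuine cardinalities with nonzero denominator and
  lie in the unit interval.\<close>

definition conj_ratio :: "('a, 'b) monoid_scheme \<Rightarrow> 'a set \<Rightarrow> ereal" where
  "conj_ratio G S =
     limsup (\<lambda>n. ereal (real (card (conj_classes_ball G S n)) / real (card (word_ball G S n))))"

primrec lower_central :: "('a, 'b) monoid_scheme \<Rightarrow> nat \<Rightarrow> 'a set" where
  "lower_central G 0 = carrier G"
| "lower_central G (Suc n) = generate G
     {h \<otimes>\<^bsub>G\<^esub> g \<otimes>\<^bsub>G\<^esub> inv\<^bsub>G\<^esub> h \<otimes>\<^bsub>G\<^esub> inv\<^bsub>G\<^esub> g | h g.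
        h \<in> lower_central G n \<and> g \<in> carrier G}"

definition nilpotent_group :: "('a, 'b) monoid_scheme \<Rightarrow> bool" where
  "nilpotent_group G \<longleftrightarrow> group G \<and> (\<exists>n. lower_central G n = {\<one>\<^bsub>G\<^esub>})"

definition finite_index :: "'a set \<Rightarrow> ('a, 'b) monoid_scheme \<Rightarrow> bool" where
  "finite_index H G \<longleftrightarrow> subgroup H G \<and> finite (rcosets\<^bsub>G\<^esub> H)"

definition virtually_nilpotent :: "('a, 'b) monoid_scheme \<Rightarrow> bool" where
  "virtually_nilpotent G \<longleftrightarrow> (\<exists>H. finite_index H G \<and> nilpotent_group (G\<lparr>carrier := H\<rparr>))"

definition virtually_abelian :: "('a, 'b) monoid_scheme \<Rightarrow> bool" where
  "virtually_abelian G \<longleftrightarrow> (\<exists>H. finite_index H G \<and> comm_group (G\<lparr>carrier := H\<rparr>))"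

end

(* The growth of G is polynomial: this reduces to a finite subset of a nilpotent subgroup of finite
   index by Schreier's rewriting, and there, going down the lower central series, words with the same
   letter counts differ by a word of polynomially bounded length in deeper commutators.

   If an abelian subgroup A has index d, then a conjugacy class meeting A has at most d elements,
   while A occupies a fixed proportion of every ball; so the ratio stays bounded away from 0.

   Conversely, fix M. A class meeting B(n) either has at least M elements in B(n), and these
   classes number at most |B(n)|/M, or it contains an element g of B(n) whose cyclic rotations give fewer
   than M conjugates. By Schreier's argument such a g lies in the centre of the subgroup generated by
   its own centralizer in B(2M + 1). Only finitely many subgroups arise in this way, all abelian, hence
   of infinite index if G is not virtually abelian, and subgroups of infinite index have density 0 in
   the balls of a group of polynomial growth. *)

theory Submission
  imports Defs
begin

subsection \<open>Balls as sets of word products\<close>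

text \<open>The alphabet \<open>F\<close> need not be closed under inverses: the growth bound for
  nilpotent groups counts the occurrences of each letter in a word. Word balls are the case
  \<open>F = symm_gens G S\<close>, by \<open>word_ball_eq_products\<close>.\<close>

definition products :: "('a, 'b) monoid_scheme \<Rightarrow> 'a set \<Rightarrow> nat \<Rightarrow> 'a set" where
  "products G F n = word_prod G ` {ws \<in> lists F. length ws \<le> n}"

definition conj_class :: "('a, 'b) monoid_scheme \<Rightarrow> 'a \<Rightarrow> 'a set" where
  "conj_class G x = (\<lambda>g. g \<otimes>\<^bsub>G\<^esub> x \<otimes>\<^bsub>G\<^esub> inv\<^bsub>G\<^esub> g) ` carrier G"

lemma finite_products: "finite F \<Longrightarrow> finite (products G F n)"
  unfolding products_def using finite_lists_length_le[of F n] by (simp add: lists_eq_set)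

lemma products_mono: "F \<subseteq> F' \<Longrightarrow> n \<le> n' \<Longrightarrow> products G F n \<subseteq> products G F' n'"
  unfolding products_def by fastforce

lemma products_weaken:
  "g \<in> products G F m \<Longrightarrow> m \<le> n \<Longrightarrow> F \<subseteq> F' \<Longrightarrow> g \<in> products G F' n"
  using products_mono by blast

lemma word_prod_Nil [simp]: "word_prod G [] = \<one>\<^bsub>G\<^esub>"
  and word_prod_Cons [simp]: "word_prod G (x # ws) = x \<otimes>\<^bsub>G\<^esub> word_prod G ws"
  by (simp_all add: word_prod_def)

lemma one_in_products: "\<one>\<^bsub>G\<^esub> \<in> products G F n"
  unfolding products_def by (force intro: image_eqI[where x = "[]"])

lemma products_I: "ws \<in> lists F \<Longrightarrow> length ws \<le> n \<Longrightarrow> word_prod G ws \<in> products G F n"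
  unfolding products_def by blast

lemma products_E:
  assumes "g \<in> products G F n"
  obtains ws where "ws \<in> lists F" "length ws \<le> n" "g = word_prod G ws"
  using assms unfolding products_def by blast

lemma card_products_pos: "finite F \<Longrightarrow> card (products G F n) > 0"
  using one_in_products[of G F n] finite_products[of F G n] by (auto simp: card_gt_0_iff)

context group
begin

lemma inv_mult_cancel: "x \<in> carrier G \<Longrightarrow> y \<in> carrier G \<Longrightarrow> inv x \<otimes> (x \<otimes> y) = y"
  and mult_inv_cancel: "x \<in> carrier G \<Longrightarrow> y \<in> carrier G \<Longrightarrow> x \<otimes> (inv x \<otimes> y) = y"
  by (simp_all add: m_assoc[symmetric])

lemmas group_simps = m_assoc inv_mult_group inv_mult_cancel mult_inv_cancel

lemma word_prod_closed [simp]: "ws \<in> lists (carrier G) \<Longrightarrow> word_prod G ws \<in> carrier G"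
  by (induction ws) auto

lemma word_prod_append:
  "ws \<in> lists (carrier G) \<Longrightarrow> vs \<in> lists (carrier G) \<Longrightarrow>
    word_prod G (ws @ vs) = word_prod G ws \<otimes> word_prod G vs"
  by (induction ws) (auto simp: m_assoc)

lemma word_prod_in_subgroup:
  assumes "subgroup H G" "ws \<in> lists H" shows "word_prod G ws \<in> H"
  using assms(2) by (induction ws) (auto intro: subgroup.one_closed[OF assms(1)] subgroup.m_closed[OF assms(1)])

lemma products_subset_subgroup: "subgroup H G \<Longrightarrow> F \<subseteq> H \<Longrightarrow> products G F n \<subseteq> H"
  unfolding products_def using word_prod_in_subgroup lists_mono by blast

lemma products_closed: "F \<subseteq> carrier G \<Longrightarrow> products G F n \<subseteq> carrier G"
  using products_subset_subgroup subgroup_self by blast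

lemma mult_in_products:
  assumes F: "F \<subseteq> carrier G" and "g \<in> products G F m" "h \<in> products G F n"
  shows "g \<otimes> h \<in> products G F (m + n)"
proof -
  obtain ws where ws: "ws \<in> lists F" "length ws \<le> m" "g = word_prod G ws"
    using assms(2) by (rule products_E)
  obtain vs where vs: "vs \<in> lists F" "length vs \<le> n" "h = word_prod G vs"
    using assms(3) by (rule products_E)
  have "g \<otimes> h = word_prod G (ws @ vs)"
    using ws vs F lists_mono[OF F] by (subst word_prod_append) auto
  then show ?thesis using ws vs by (auto intro!: products_I)
qed

lemma products_split:
  assumes F: "F \<subseteq> carrier G" and "x \<in> products G F (m + n)"
  obtains g h where "g \<in> products G F m" "h \<in> products G F n" "x = g \<otimes> h"
proof -
  obtain ws where ws: "ws \<in> lists F" "length ws \<le> m + n" "x = word_prod G ws"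
    using assms(2) by (rule products_E)
  have t: "take m ws \<in> lists F" "drop m ws \<in> lists F"
    using ws(1) by (auto dest: in_set_takeD in_set_dropD)
  have "x = word_prod G (take m ws) \<otimes> word_prod G (drop m ws)"
    using t lists_mono[OF F] ws(3) by (subst word_prod_append[symmetric]) auto
  then show ?thesis using t ws by (intro that) (auto intro!: products_I)
qed

lemma inv_word_prod:
  assumes "ws \<in> lists (carrier G)"
  shows "inv (word_prod G ws) = word_prod G (rev (map (m_inv G) ws))"
  using assms
proof (induction ws)
  case (Cons x ws)
  have "rev (map (m_inv G) ws) \<in> lists (carrier G)" using Cons.hyps by auto
  then show ?case using Cons by (simp add: word_prod_append inv_mult_group)
qed simp

text \<open>Two alphabets are allowed so that inverses of words over \<open>D\<close> can be read
  over \<open>symm_gens G D\<close>; for a symmetric alphabet \<open>F' = F\<close>.\<close>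

lemma inv_in_products:
  assumes F: "F \<subseteq> carrier G" and "\<And>x. x \<in> F \<Longrightarrow> inv x \<in> F'" and "g \<in> products G F n"
  shows "inv g \<in> products G F' n"
proof -
  obtain ws where ws: "ws \<in> lists F" "length ws \<le> n" "g = word_prod G ws"
    using assms(3) by (rule products_E)
  have "inv g = word_prod G (rev (map (m_inv G) ws))"
    using ws F lists_mono[OF F] by (subst inv_word_prod[symmetric]) auto
  moreover have "rev (map (m_inv G) ws) \<in> lists F'" using ws(1) assms(2) by auto
  ultimately show ?thesis using ws by (auto intro!: products_I)
qed

section \<open>Comparison with balls for the word length\<close>

lemma symm_gens_closed: "S \<subseteq> carrier G \<Longrightarrow> symm_gens G S \<subseteq> carrier G"
  unfolding symm_gens_def by auto

lemma symm_gens_inv: "S \<subseteq> carrier G \<Longrightarrow> x \<in> symm_gens G S \<Longrightarrow> inv x \<in> symm_gens G S"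
  unfolding symm_gens_def by auto

lemma word_prod_in_generate:
  assumes "S \<subseteq> carrier G" "ws \<in> lists (symm_gens G S)"
  shows "word_prod G ws \<in> generate G S"
proof (rule word_prod_in_subgroup)
  show "subgroup (generate G S) G" using assms(1) by (rule generate_is_subgroup)
  have "symm_gens G S \<subseteq> generate G S"
    unfolding symm_gens_def by (auto intro: generate.incl generate.inv)
  then show "ws \<in> lists (generate G S)" using assms(2) by auto
qed

lemma generate_imp_word_prod:
  assumes S: "S \<subseteq> carrier G" and "g \<in> generate G S"
  shows "\<exists>ws \<in> lists (symm_gens G S). word_prod G ws = g"
  using assms(2)
proof (induction rule: generate.induct)
  case one
  show ?case by (intro bexI[of _ "[]"]) auto
next
  case (incl h)
  then show ?case using S by (intro bexI[of _ "[h]"]) (auto simp: symm_gens_def)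
next
  case (inv h)
  then show ?case using S by (intro bexI[of _ "[inv h]"]) (auto simp: symm_gens_def)
next
  case (eng h1 h2)
  then obtain ws vs where "ws \<in> lists (symm_gens G S)" "word_prod G ws = h1"
      "vs \<in> lists (symm_gens G S)" "word_prod G vs = h2" by blast
  moreover from this have "ws \<in> lists (carrier G)" "vs \<in> lists (carrier G)"
    using lists_mono[OF symm_gens_closed[OF S]] by blast+
  ultimately show ?case by (intro bexI[of _ "ws @ vs"]) (auto simp: word_prod_append)
qed

lemma word_ball_eq_products:
  assumes S: "S \<subseteq> carrier G"
  shows "word_ball G S n = products G (symm_gens G S) n"
proof (intro equalityI subsetI)
  fix g assume "g \<in> word_ball G S n"
  then have g: "g \<in> generate G S" "word_length G S g \<le> n" by (auto simp: word_ball_def)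
  have "\<exists>k. \<exists>ws \<in> lists (symm_gens G S). length ws = k \<and> word_prod G ws = g"
    using generate_imp_word_prod[OF S g(1)] by blast
  then have "\<exists>ws \<in> lists (symm_gens G S). length ws = word_length G S g \<and> word_prod G ws = g"
    unfolding word_length_def by (rule LeastI_ex)
  then show "g \<in> products G (symm_gens G S) n" using g(2) by (auto intro: products_I)
next
  fix g assume "g \<in> products G (symm_gens G S) n"
  then obtain ws where ws: "ws \<in> lists (symm_gens G S)" "length ws \<le> n" "g = word_prod G ws"
    by (rule products_E)
  have "word_length G S g \<le> length ws"
    unfolding word_length_def using ws by (intro Least_le) blast
  then show "g \<in> word_ball G S n"
    unfolding word_ball_def using ws word_prod_in_generate[OF S ws(1)] by auto
qed

section \<open>Conjugacy classes meeting a ball\<close>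

lemma conj_classes_eq: "conj_classes G = conj_class G ` carrier G"
  unfolding conj_classes_def orbits_def orbit_def conj_class_def by (auto simp: image_def)

lemma conj_class_self: "x \<in> carrier G \<Longrightarrow> x \<in> conj_class G x"
  unfolding conj_class_def by (rule image_eqI[of _ _ \<one>]) auto

lemma conj_class_eqI:
  assumes "x \<in> carrier G" "y \<in> conj_class G x" shows "conj_class G y = conj_class G x"
proof -
  obtain a where a: "a \<in> carrier G" "y = a \<otimes> x \<otimes> inv a"
    using assms(2) unfolding conj_class_def by blast
  have "(\<lambda>g. g \<otimes> y \<otimes> inv g) ` carrier G = (\<lambda>g. g \<otimes> x \<otimes> inv g) ` ((\<lambda>g. g \<otimes> a) ` carrier G)"
    unfolding image_image using a assms(1) by (intro image_cong) (auto simp: group_simps)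
  also have "(\<lambda>g. g \<otimes> a) ` carrier G = carrier G"
  proof (intro equalityI subsetI)
    fix g assume "g \<in> carrier G"
    then show "g \<in> (\<lambda>g. g \<otimes> a) ` carrier G"
      using a(1) by (intro image_eqI[of _ _ "g \<otimes> inv a"]) (auto simp: group_simps)
  qed (use a(1) in auto)
  finally show ?thesis unfolding conj_class_def .
qed

text \<open>A class that meets the ball is the class of any of its elements there, so counting
  classes becomes counting the image of a ball.\<close>

lemma conj_classes_ball_eq:
  assumes S: "S \<subseteq> carrier G"
  shows "conj_classes_ball G S n = conj_class G ` word_ball G S n"
proof -
  have B: "word_ball G S n \<subseteq> carrier G"
    unfolding word_ball_eq_products[OF S] by (rule products_closed[OF symm_gens_closed[OF S]])
  show ?thesis
  proof (intro equalityI subsetI)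
    fix K assume "K \<in> conj_classes_ball G S n"
    then obtain x y where "K = conj_class G x" "x \<in> carrier G" "y \<in> K" "y \<in> word_ball G S n"
      unfolding conj_classes_ball_def conj_classes_eq by blast
    then show "K \<in> conj_class G ` word_ball G S n" using conj_class_eqI[of x y] by auto
  next
    fix K assume "K \<in> conj_class G ` word_ball G S n"
    then show "K \<in> conj_classes_ball G S n"
      unfolding conj_classes_ball_def conj_classes_eq using B conj_class_self by blast
  qed
qed

subsection \<open>Subgroups of finite and infinite index\<close>

lemma rcoset_representatives:
  "\<exists>f. \<forall>K \<in> rcosets H. f K \<in> carrier G \<and> K = H #> f K"
  by (intro bchoice) (auto simp: RCOSETS_def)

lemma finite_index_transversal:
  assumes "finite_index H G"
  obtains T where "finite T" "T \<subseteq> carrier G"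
    "\<forall>g \<in> carrier G. \<exists>h\<in>H. \<exists>t\<in>T. g = h \<otimes> t"
proof -
  have H: "subgroup H G" and fin: "finite (rcosets H)"
    using assms by (auto simp: finite_index_def)
  obtain f where f: "\<forall>K \<in> rcosets H. f K \<in> carrier G \<and> K = H #> f K"
    using rcoset_representatives[of H] by (rule exE)
  show ?thesis
  proof
    show "finite (f ` (rcosets H))" using fin by simp
    show "f ` (rcosets H) \<subseteq> carrier G" using f by auto
  next
    show "\<forall>g \<in> carrier G. \<exists>h\<in>H. \<exists>t\<in>f ` (rcosets H). g = h \<otimes> t"
    proof
      fix g assume g: "g \<in> carrier G"
      then have "H #> g \<in> rcosets H" using H subgroup.subset rcosetsI by blast
      with f have "H #> g = H #> f (H #> g)" "f (H #> g) \<in> f ` (rcosets H)" by auto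
      moreover have "g \<in> H #> g" using g H by (rule rcos_self)
      ultimately show "\<exists>h\<in>H. \<exists>t\<in>f ` (rcosets H). g = h \<otimes> t"
        unfolding r_coset_def by blast
    qed
  qed
qed

text \<open>\<open>Y\<close> represents \<open>m\<close> distinct right cosets. As these are
  disjoint, a product \<open>h \<otimes> x\<close> determines its coset, hence \<open>x\<close>,
  hence \<open>h\<close>. This gives many disjoint translates of any finite piece of
  \<open>H\<close>.\<close>

lemma infinite_index_separated:
  assumes H: "subgroup H G" and "\<not> finite_index H G"
  obtains Y where "finite Y" "Y \<subseteq> carrier G" "card Y = m"
    "inj_on (\<lambda>(h, x). h \<otimes> x) (H \<times> Y)"
proof -
  have "infinite (rcosets H)" using assms by (auto simp: finite_index_def)
  then obtain Q where Q: "Q \<subseteq> rcosets H" "finite Q" "card Q = m"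
    using infinite_arbitrarily_large by blast
  obtain f where f: "\<forall>K \<in> rcosets H. f K \<in> carrier G \<and> K = H #> f K"
    using rcoset_representatives[of H] by (rule exE)
  have "inj_on f Q" using f Q(1) by (metis inj_onI subsetD)
  then have "card (f ` Q) = m" using Q by (simp add: card_image)
  moreover have "inj_on (\<lambda>(h, x). h \<otimes> x) (H \<times> f ` Q)"
  proof (rule inj_onI, clarsimp)
    fix h h' K K' assume h: "h \<in> H" "h' \<in> H" and K: "K \<in> Q" "K' \<in> Q"
      and eq: "h \<otimes> f K = h' \<otimes> f K'"
    have c: "h \<in> carrier G" "h' \<in> carrier G" "f K \<in> carrier G" "f K' \<in> carrier G"
      using h K f Q(1) subgroup.subset[OF H] by auto
    have KK: "K = H #> f K" "K' = H #> f K'" using f K Q(1) by auto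
    have "h \<otimes> f K \<in> H #> f K" "h' \<otimes> f K' \<in> H #> f K'"
      using h unfolding r_coset_def by auto
    then have "h \<otimes> f K \<in> K" "h \<otimes> f K \<in> K'" using KK eq by simp_all
    then have "K = K'" using Q(1) K rcos_disjoint[OF H] unfolding pairwise_def disjnt_def by blast
    then show "h = h' \<and> f K = f K'" using eq c by auto
  qed
  ultimately show ?thesis using Q f by (intro that[of "f ` Q"]) auto
qed

end

subsection \<open>Polynomial growth\<close>

text \<open>With base \<^term>\<open>n + 2\<close>, constant factors are absorbed into the exponent, so that
  polynomially bounded functions are closed under products and composition.\<close>

lemma growth_bound_comp:
  "((n + 2) ^ d + 2) ^ e \<le> (n + 2 :: nat) ^ ((d + 2) * e)"
proof -
  have "1 \<le> (n + 2) ^ d" by simp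
  then have "(n + 2) ^ d + 2 \<le> (n + 2) ^ d * 2 ^ 2" unfolding power2_eq_square by linarith
  also have "\<dots> \<le> (n + 2) ^ d * (n + 2) ^ 2" by (intro mult_le_mono2 power_mono) auto
  finally have "(n + 2) ^ d + 2 \<le> (n + 2) ^ (d + 2)" by (simp only: power_add)
  then show ?thesis by (simp only: power_mult) (intro power_mono, auto)
qed

context group
begin

section \<open>Commutators along the lower central series\<close>

declare lower_central.simps(2) [simp del]

abbreviation \<gamma> where "\<gamma> \<equiv> lower_central G"

lemma lower_central_closed: "\<gamma> i \<subseteq> carrier G"
proof (induction i)
  case (Suc i)
  show ?case unfolding lower_central.simps using Suc by (intro generate_incl) auto
qed simp

lemma lower_central_subgroup: "subgroup (\<gamma> i) G"
proof (cases i)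
  case (Suc j)
  show ?thesis unfolding Suc lower_central.simps
    using lower_central_closed[of j] by (intro generate_is_subgroup) auto
qed (simp add: subgroup_self)

lemma lower_central_Suc_subset: "\<gamma> (Suc i) \<subseteq> \<gamma> i"
proof (induction i)
  case 0
  show ?case using lower_central_closed[of "Suc 0"] by simp
next
  case (Suc i)
  show ?case
    by (subst (1 2) lower_central.simps(2), rule mono_generate) (use Suc in blast)
qed

definition comm :: "'a \<Rightarrow> 'a \<Rightarrow> 'a" where
  "comm g h = g \<otimes> h \<otimes> inv g \<otimes> inv h"

lemma comm_closed [simp]: "g \<in> carrier G \<Longrightarrow> h \<in> carrier G \<Longrightarrow> comm g h \<in> carrier G"
  by (simp add: comm_def)

lemma comm_in_lower_central:
  assumes g: "g \<in> carrier G" and h: "h \<in> \<gamma> i"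
  shows "comm g h \<in> \<gamma> (Suc i)"
proof -
  have hc: "h \<in> carrier G" using h lower_central_closed by blast
  have "h \<otimes> g \<otimes> inv h \<otimes> inv g \<in> \<gamma> (Suc i)"
    unfolding lower_central.simps using g h by (intro generate.incl) blast
  \<comment> \<open>The generators of the next term carry the deeper element in first position, so
    \<open>comm g h\<close> is reached as the inverse of one of them.\<close>
  then have "inv (h \<otimes> g \<otimes> inv h \<otimes> inv g) \<in> \<gamma> (Suc i)"
    by (rule subgroup.m_inv_closed[OF lower_central_subgroup])
  also have "inv (h \<otimes> g \<otimes> inv h \<otimes> inv g) = comm g h"
    using g hc by (simp add: comm_def group_simps)
  finally show ?thesis .
qed

text \<open>Rests on the identity \<open>[gf, h] = [g, [f, h]] [f, h] [g, h]\<close>: each further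
  letter \<open>f\<close> of the word costs at most \<open>k + 1\<close> letters of
  \<open>D\<close>.\<close>

lemma comm_word_in_products:
  assumes F: "F \<subseteq> carrier G" and H: "H \<subseteq> carrier G"
    and D: "D \<subseteq> carrier G" "\<And>f h. f \<in> F \<Longrightarrow> h \<in> H \<Longrightarrow> comm f h \<in> D"
    and step: "\<And>g f h. g \<in> products G F n \<Longrightarrow> f \<in> F \<Longrightarrow> h \<in> H \<Longrightarrow>
        comm g (comm f h) \<in> products G D k"
    and h: "h \<in> H"
  shows "ws \<in> lists F \<Longrightarrow> length ws \<le> n \<Longrightarrow>
    comm (word_prod G ws) h \<in> products G D (length ws * (k + 1))"
proof (induction ws rule: rev_induct)
  case Nil
  have "comm \<one> h = \<one>" using h H by (auto simp: comm_def)
  then show ?case by (simp add: one_in_products)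
next
  case (snoc f ws)
  let ?g = "word_prod G ws"
  have ws: "ws \<in> lists F" "f \<in> F" using snoc.prems by auto
  have c: "?g \<in> carrier G" "f \<in> carrier G" "h \<in> carrier G"
    using ws F H h lists_mono[OF F] by (auto intro!: word_prod_closed)
  have "comm (word_prod G (ws @ [f])) h = comm ?g (comm f h) \<otimes> (comm f h \<otimes> comm ?g h)"
    using c ws lists_mono[OF F] by (subst word_prod_append) (auto simp: comm_def group_simps)
  moreover have "comm ?g (comm f h) \<in> products G D k"
    using step ws h snoc.prems by (intro step products_I) auto
  moreover have "comm f h \<in> products G D 1"
    using products_I[of "[comm f h]" D 1 G] D ws h c by auto
  moreover have "comm ?g h \<in> products G D (length ws * (k + 1))"
    using snoc by auto
  ultimately have "comm (word_prod G (ws @ [f])) h \<in> products G D (k + (1 + length ws * (k + 1)))"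
    using D(1) by (auto intro!: mult_in_products simp del: One_nat_def)
  then show ?case by (simp add: algebra_simps)
qed

text \<open>Downward induction on \<open>i\<close>. The commutators of letters with elements of
  \<open>H\<close> form a finite subset of the next term, to which the induction hypothesis applies;
  \<open>comm_word_in_products\<close> then passes from letters to words. It matters that
  \<open>D\<close> and \<open>d\<close> are independent of \<open>n\<close>.\<close>

lemma comm_poly_bound:
  assumes nil: "\<gamma> c = {\<one>}" and "finite F" "F \<subseteq> carrier G" and "finite H" "H \<subseteq> \<gamma> i" "i \<le> c"
  shows "\<exists>D d. finite D \<and> D \<subseteq> \<gamma> (Suc i) \<and>
    (\<forall>n. \<forall>g \<in> products G F n. \<forall>h \<in> H. comm g h \<in> products G D ((n + 2) ^ d))"
  using assms(6,4,5)
proof (induction i arbitrary: H rule: inc_induct)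
  case base
  have "comm g h \<in> products G {} ((n + 2) ^ 0)" if "g \<in> products G F n" "h \<in> H" for g h n
  proof -
    have "g \<in> carrier G" "h = \<one>" using that base nil products_closed[OF assms(3)] by auto
    then have "comm g h = \<one>" by (simp add: comm_def)
    then show ?thesis by (simp add: one_in_products)
  qed
  then show ?case by (intro exI[of _ "{}"] exI[of _ 0]) auto
next
  case (step i)
  have HC: "H \<subseteq> carrier G" using step.prems lower_central_closed by blast
  let ?H1 = "(\<lambda>(f, h). comm f h) ` (F \<times> H)"
  have fin: "finite ?H1" using assms(2) step.prems by simp
  have H1: "?H1 \<subseteq> \<gamma> (Suc i)"
  proof clarify
    fix f h assume "f \<in> F" "h \<in> H"
    then show "comm f h \<in> \<gamma> (Suc i)"
      by (intro comm_in_lower_central subsetD[OF assms(3)] subsetD[OF step.prems(2)])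
  qed
  obtain D d where D: "finite D" "D \<subseteq> \<gamma> (Suc (Suc i))"
    and Dd: "\<forall>n. \<forall>g \<in> products G F n. \<forall>h \<in> ?H1. comm g h \<in> products G D ((n + 2) ^ d)"
    using step.IH[OF fin H1] by (elim exE conjE) (rule that)
  let ?D = "?H1 \<union> D"
  have D_sub: "?D \<subseteq> \<gamma> (Suc i)" using H1 D lower_central_Suc_subset by blast
  have "comm g h \<in> products G ?D ((n + 2) ^ (d + 2))"
    if g: "g \<in> products G F n" and h: "h \<in> H" for g h n
  proof -
    obtain ws where ws: "ws \<in> lists F" "length ws \<le> n" "g = word_prod G ws"
      using g by (rule products_E)
    have "comm (word_prod G ws) h \<in> products G ?D (length ws * ((n + 2) ^ d + 1))"
    proof (rule comm_word_in_products[OF assms(3) HC _ _ _ h ws(1,2)])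
      show "?D \<subseteq> carrier G" using D_sub lower_central_closed by blast
    next
      fix g f h assume "g \<in> products G F n" "f \<in> F" "h \<in> H"
      then have "comm g (comm f h) \<in> products G D ((n + 2) ^ d)" using Dd by blast
      then show "comm g (comm f h) \<in> products G ?D ((n + 2) ^ d)"
        by (rule products_weaken) auto
    qed auto
    moreover have "length ws * ((n + 2) ^ d + 1) \<le> (n + 2) ^ (d + 2)"
    proof -
      have "length ws * ((n + 2) ^ d + 1) \<le> (n + 2) * ((n + 2) ^ d * (n + 2))"
      proof (rule mult_le_mono)
        have "1 \<le> (n + 2) ^ d" by simp
        then show "(n + 2) ^ d + 1 \<le> (n + 2) ^ d * (n + 2)" unfolding add_mult_distrib2 by linarith
      qed (use ws(2) in simp)
      then show ?thesis by (simp add: algebra_simps power2_eq_square)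
    qed
    ultimately show ?thesis unfolding ws(3) by (rule products_weaken) simp
  qed
  moreover have "finite ?D" using assms(2) step.prems D by simp
  ultimately show ?case using D_sub by blast
qed

text \<open>The last letter \<open>f\<close> of \<open>ws\<close> occurs in \<open>vs\<close> as
  \<open>xs @ f # ys\<close>. With \<open>x\<close> and \<open>y\<close> the products of
  \<open>xs\<close> and \<open>ys\<close>, moving it to the end uses
  \<open>x f y = [x, f] [xy, f]^-1 x y f\<close>, that is, at most \<open>2 * k\<close> letters;
  then \<open>ws\<close> is compared with \<open>xs @ ys\<close>.\<close>

lemma permuted_words_diff:
  assumes F: "F \<subseteq> carrier G" and D: "D \<subseteq> carrier G"
    and cm: "\<And>g f. g \<in> products G F n \<Longrightarrow> f \<in> F \<Longrightarrow> comm g f \<in> products G D k"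
  shows "ws \<in> lists F \<Longrightarrow> length ws \<le> n \<Longrightarrow> mset ws = mset vs \<Longrightarrow>
    word_prod G vs \<otimes> inv (word_prod G ws) \<in> products G (symm_gens G D) (length ws * (2 * k))"
proof (induction ws arbitrary: vs rule: rev_induct)
  case Nil
  then show ?case by (simp add: one_in_products)
next
  case (snoc f ws)
  have Sc: "symm_gens G D \<subseteq> carrier G" using D by (rule symm_gens_closed)
  have "f \<in> set vs" using snoc.prems(3) by (metis in_set_conv_decomp mset_eq_setD)
  then obtain xs ys where vs: "vs = xs @ f # ys" by (auto dest: split_list)
  have m: "mset ws = mset (xs @ ys)" using snoc.prems(3) vs by simp
  have ws: "ws \<in> lists F" "f \<in> F" using snoc.prems by auto
  have "set (xs @ ys) = set ws" using m by (metis mset_eq_setD)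
  then have xy: "xs \<in> lists F" "ys \<in> lists F" using ws by auto
  have len: "length ws = length xs + length ys" using m by (metis length_append size_mset)
  let ?w = "word_prod G ws" and ?x = "word_prod G xs" and ?y = "word_prod G ys"
  have L: "ws \<in> lists (carrier G)" "xs \<in> lists (carrier G)" "ys \<in> lists (carrier G)"
    using ws xy lists_mono[OF F] by auto
  have c: "?w \<in> carrier G" "?x \<in> carrier G" "?y \<in> carrier G" "f \<in> carrier G"
    using L ws F by (auto simp del: in_lists_conv_set)
  have inter: "word_prod G vs \<otimes> inv (word_prod G (ws @ [f])) =
      comm ?x f \<otimes> (inv (comm (?x \<otimes> ?y) f) \<otimes> (word_prod G (xs @ ys) \<otimes> inv ?w))"
    using c L by (simp add: vs word_prod_append comm_def group_simps)
  have "?x \<in> products G F n" using xy snoc.prems len by (intro products_I) auto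
  then have 1: "comm ?x f \<in> products G (symm_gens G D) k"
    using ws by (intro products_weaken[OF cm]) (auto simp: symm_gens_def)
  have "word_prod G (xs @ ys) \<in> products G F n" using xy snoc.prems(2) len by (intro products_I) auto
  then have "?x \<otimes> ?y \<in> products G F n" using L by (simp add: word_prod_append)
  then have "comm (?x \<otimes> ?y) f \<in> products G D k" using cm ws by blast
  then have 2: "inv (comm (?x \<otimes> ?y) f) \<in> products G (symm_gens G D) k"
    by (rule inv_in_products[OF D, rotated]) (auto simp: symm_gens_def)
  have 3: "word_prod G (xs @ ys) \<otimes> inv ?w \<in> products G (symm_gens G D) (length ws * (2 * k))"
    using snoc m by auto
  have "word_prod G vs \<otimes> inv (word_prod G (ws @ [f]))
      \<in> products G (symm_gens G D) (k + (k + length ws * (2 * k)))"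
    unfolding inter by (intro mult_in_products[OF Sc] 1 2 3)
  then show ?case by (simp add: algebra_simps)
qed

text \<open>A product is determined by the letter counts of a word and its difference from a fixed
  word with the same counts. There are polynomially many counts, and by
  \<open>permuted_words_diff\<close> the differences are polynomially long words over a finite
  subset of the next term, where the downward induction bounds their number.\<close>

lemma nilpotent_growth_lower_central:
  assumes nil: "\<gamma> c = {\<one>}" and "i \<le> c" "finite F" "F \<subseteq> \<gamma> i"
  shows "\<exists>d. \<forall>n. card (products G F n) \<le> (n + 2) ^ d"
  using assms(2,3,4)
proof (induction i arbitrary: F rule: inc_induct)
  case base
  have "products G F n \<subseteq> {\<one>}" for n
    using products_subset_subgroup[OF lower_central_subgroup base(2)] nil by blast
  then have "card (products G F n) \<le> (n + 2) ^ 0" for n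
    using card_mono[of "{\<one>}"] by simp
  then show ?case by blast
next
  case (step i)
  have F: "F \<subseteq> carrier G" using step.prems lower_central_closed by blast
  obtain D d where D: "finite D" "D \<subseteq> \<gamma> (Suc i)"
    and Dd: "\<forall>n. \<forall>g \<in> products G F n. \<forall>h \<in> F. comm g h \<in> products G D ((n + 2) ^ d)"
    using comm_poly_bound[OF nil step.prems(1) F step.prems less_imp_le[OF step.hyps(2)]]
    by (elim exE conjE) (rule that)
  let ?D = "symm_gens G D"
  have DC: "D \<subseteq> carrier G" using D lower_central_closed by blast
  have "?D \<subseteq> \<gamma> (Suc i)" using D(2) subgroup.m_inv_closed[OF lower_central_subgroup]
    by (auto simp: symm_gens_def)
  moreover have finD: "finite ?D" using D by (simp add: symm_gens_def)
  ultimately obtain e where e: "\<And>n. card (products G ?D n) \<le> (n + 2) ^ e"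
    using step.IH by blast
  \<comment> \<open>The summand \<open>card F\<close> accounts for the letter counts; the other one
    is the exponent given by \<open>growth_bound_comp\<close> for growth of degree \<open>e\<close>
    at radius \<open>(n + 2) ^ (d + 2)\<close>.\<close>
  have "card (products G F n) \<le> (n + 2) ^ (card F + (d + 2 + 2) * e)" for n
  proof -
    let ?W = "{ws \<in> lists F. length ws \<le> n}"
    \<comment> \<open>Restriction to \<open>F\<close> puts the count vectors into a finite
      extensional function space; nothing is lost, since other letters have count 0.\<close>
    let ?k = "\<lambda>ws. restrict (count (mset ws)) F"
    let ?rep = "inv_into ?W ?k"
    let ?P = "products G ?D ((n + 2) ^ (d + 2))"
    have W: "finite ?W" using finite_lists_length_le[OF step.prems(1)] by (simp add: lists_eq_set)
    have "word_prod G vs \<in> (\<lambda>(\<kappa>, y). y \<otimes> word_prod G (?rep \<kappa>)) ` (?k ` ?W \<times> ?P)"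
      if vs: "vs \<in> ?W" for vs
    proof -
      let ?ws = "?rep (?k vs)"
      have ws: "?ws \<in> ?W" "?k ?ws = ?k vs"
        by (rule inv_into_into[OF imageI[OF vs]], rule f_inv_into_f[OF imageI[OF vs]])
      have "count (mset ?ws) x = count (mset vs) x" for x
      proof (cases "x \<in> F")
        case True
        then show ?thesis using fun_cong[OF ws(2), of x] by simp
      next
        case False
        then have "x \<notin># mset ?ws" "x \<notin># mset vs"
          unfolding set_mset_mset using ws(1) vs by blast+
        then show ?thesis by (simp only: not_in_iff)
      qed
      then have m: "mset ?ws = mset vs" by (intro multiset_eqI)
      have "word_prod G vs \<otimes> inv (word_prod G ?ws)
          \<in> products G ?D (length ?ws * (2 * (n + 2) ^ d))"
      proof (rule permuted_words_diff[OF F DC _ _ _ m])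
        show "comm g f \<in> products G D ((n + 2) ^ d)" if "g \<in> products G F n" "f \<in> F" for g f
          using Dd that by blast
      qed (use ws(1) in auto)
      moreover have "length ?ws * (2 * (n + 2) ^ d) \<le> (n + 2) * ((n + 2) * (n + 2) ^ d)"
        using ws(1) by (intro mult_le_mono) auto
      ultimately have "word_prod G vs \<otimes> inv (word_prod G ?ws) \<in> ?P"
        by (elim products_weaken) (auto simp: power2_eq_square mult_ac)
      moreover have "word_prod G vs \<otimes> inv (word_prod G ?ws) \<otimes> word_prod G ?ws = word_prod G vs"
      proof -
        have "vs \<in> lists (carrier G)" "?ws \<in> lists (carrier G)"
          using vs ws(1) lists_mono[OF F] by blast+
        then show ?thesis by (simp add: m_assoc del: in_lists_conv_set)
      qed
      ultimately show ?thesis using vs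
        by (intro image_eqI[of _ _ "(?k vs, word_prod G vs \<otimes> inv (word_prod G ?ws))"]) auto
    qed
    then have "products G F n \<subseteq> (\<lambda>(\<kappa>, y). y \<otimes> word_prod G (?rep \<kappa>)) ` (?k ` ?W \<times> ?P)"
      unfolding products_def[of G F] by blast
    then have "card (products G F n) \<le> card (?k ` ?W \<times> ?P)"
      by (rule surj_card_le[OF finite_cartesian_product[OF finite_imageI[OF W] finite_products[OF finD]]])
    also have "\<dots> = card (?k ` ?W) * card ?P" by (rule card_cartesian_product)
    also have "\<dots> \<le> (n + 2) ^ card F * (n + 2) ^ ((d + 2 + 2) * e)"
    proof (rule mult_le_mono)
      have "?k ` ?W \<subseteq> F \<rightarrow>\<^sub>E {..n}"
      proof (intro image_subsetI restrict_PiE_iff[THEN iffD2] ballI)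
        fix ws x assume "ws \<in> ?W"
        then show "count (mset ws) x \<in> {..n}"
          using count_le_size[of "mset ws" x] le_trans[of _ "length ws" n] by simp
      qed
      moreover have "finite (F \<rightarrow>\<^sub>E {..n})" using step.prems by (intro finite_PiE) auto
      ultimately have "card (?k ` ?W) \<le> card (F \<rightarrow>\<^sub>E {..n})"
        by (rule card_mono[rotated])
      also have "\<dots> = (n + 1) ^ card F" using step.prems by (simp add: card_PiE)
      also have "\<dots> \<le> (n + 2) ^ card F" by (intro power_mono) auto
      finally show "card (?k ` ?W) \<le> (n + 2) ^ card F" .
      show "card ?P \<le> (n + 2) ^ ((d + 2 + 2) * e)"
        using e growth_bound_comp by (rule order_trans)
    qed
    finally show ?thesis by (simp add: power_add)
  qed
  then show ?case by blast
qed

lemma nilpotent_growth: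
  assumes "nilpotent_group G" "finite F" "F \<subseteq> carrier G"
  shows "\<exists>d. \<forall>n. card (products G F n) \<le> (n + 2) ^ d"
proof -
  obtain c where "\<gamma> c = {\<one>}" using assms(1) by (auto simp: nilpotent_group_def)
  then show ?thesis using nilpotent_growth_lower_central[of c 0 F] assms by auto
qed

end

section \<open>Growth passes from a nilpotent subgroup of finite index to the group\<close>

lemma products_carrier_update: "products (G\<lparr>carrier := H\<rparr>) F n = products G F n"
  by (simp add: products_def word_prod_def)

lemma (in group) virtually_nilpotent_growth:
  assumes "virtually_nilpotent G" "finite S" "S \<subseteq> carrier G"
  shows "\<exists>d. \<forall>n. card (products G S n) \<le> (n + 2) ^ d"
proof -
  obtain N where N: "finite_index N G" "nilpotent_group (G\<lparr>carrier := N\<rparr>)"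
    using assms(1) by (auto simp: virtually_nilpotent_def)
  have NG: "subgroup N G" using N by (simp add: finite_index_def)
  obtain T where T: "finite T" "T \<subseteq> carrier G"
    "\<forall>g \<in> carrier G. \<exists>h\<in>N. \<exists>t\<in>T. g = h \<otimes> t"
    by (rule finite_index_transversal[OF N(1)])
  \<comment> \<open>These are Schreier generators: intersecting with \<open>N\<close> keeps the
    elements for which \<open>t'\<close> represents the coset of
    \<open>t \<otimes> s\<close>.\<close>
  define F where "F = N \<inter> (\<lambda>((t, s), t'). t \<otimes> s \<otimes> inv t') ` ((T \<times> S) \<times> T)"
  have F: "finite F" "F \<subseteq> N" using T assms by (auto simp: F_def)
  have NC: "N \<subseteq> carrier G" using NG by (rule subgroup.subset)
  interpret N: group "G\<lparr>carrier := N\<rparr>" using N(2) by (simp add: nilpotent_group_def)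
  obtain d where d: "\<And>n. card (products G F n) \<le> (n + 2) ^ d"
    using N.nilpotent_growth[OF N(2) F(1)] F(2) unfolding products_carrier_update by auto
  \<comment> \<open>A coset representative is carried through the word. Each letter read emits one
    letter of \<open>F\<close>, so the length does not increase.\<close>
  have schreier: "\<exists>f \<in> products G F (length ws). \<exists>t' \<in> T. t \<otimes> word_prod G ws = f \<otimes> t'"
    if "ws \<in> lists S" "t \<in> T" for ws t
    using that
  proof (induction ws arbitrary: t)
    case Nil
    then show ?case using T(2) by (intro bexI[of _ \<one>] bexI[of _ t]) (auto simp: one_in_products)
  next
    case (Cons s ws)
    have c: "t \<in> carrier G" "s \<in> carrier G" "word_prod G ws \<in> carrier G"
      using Cons T(2) assms(3) lists_mono[OF assms(3)] by (auto intro!: word_prod_closed)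
    obtain h t' where h: "h \<in> N" "t' \<in> T" "t \<otimes> s = h \<otimes> t'" using bspec[OF T(3), of "t \<otimes> s"] c by auto
    have c': "h \<in> carrier G" "t' \<in> carrier G" using h T(2) NC by auto
    have "h = t \<otimes> s \<otimes> inv t'" using h c' by (simp add: m_assoc)
    then have hF: "h \<in> F" unfolding F_def using h Cons.prems Cons.hyps
      by (auto intro!: image_eqI[of _ _ "((t, s), t')"])
    obtain f t'' where f: "f \<in> products G F (length ws)" "t'' \<in> T" "t' \<otimes> word_prod G ws = f \<otimes> t''"
      using Cons.IH[OF h(2)] by blast
    have fc: "f \<in> carrier G" "t'' \<in> carrier G"
      using f T(2) products_closed F(2) NC by blast+
    have "t \<otimes> word_prod G (s # ws) = (t \<otimes> s) \<otimes> word_prod G ws" using c by (simp add: m_assoc)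
    also have "\<dots> = h \<otimes> (t' \<otimes> word_prod G ws)" using h c c' by (simp add: m_assoc)
    also have "\<dots> = (h \<otimes> f) \<otimes> t''" using f fc c' by (simp add: m_assoc)
    finally have "t \<otimes> word_prod G (s # ws) = (h \<otimes> f) \<otimes> t''" .
    moreover have "h \<in> products G F 1" using products_I[of "[h]" F 1 G] hF c' by simp
    then have "h \<otimes> f \<in> products G F (1 + length ws)"
      using f F NC by (intro mult_in_products) auto
    ultimately show ?case using f(2) by auto
  qed
  \<comment> \<open>The transversal need not contain the identity, so rewriting starts at some
    \<open>t0\<close>, which is removed afterwards by multiplying with its inverse.\<close>
  obtain h0 t0 where t0: "h0 \<in> N" "t0 \<in> T" "\<one> = h0 \<otimes> t0" using bspec[OF T(3), of \<one>] by auto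
  have t0c: "t0 \<in> carrier G" using t0 T by auto
  have "card (products G S n) \<le> (n + 2) ^ (d + card T)" for n
  proof -
    have sub: "products G S n \<subseteq> (\<lambda>(f, t). inv t0 \<otimes> (f \<otimes> t)) ` (products G F n \<times> T)"
    proof
      fix g assume "g \<in> products G S n"
      then obtain ws where ws: "ws \<in> lists S" "length ws \<le> n" "g = word_prod G ws"
        by (rule products_E)
      obtain f t where f: "f \<in> products G F (length ws)" "t \<in> T" "t0 \<otimes> g = f \<otimes> t"
        using schreier[OF ws(1) t0(2)] ws(3) by blast
      have gc: "g \<in> carrier G" using ws lists_mono[OF assms(3)] by (auto intro!: word_prod_closed)
      have "g = inv t0 \<otimes> (t0 \<otimes> g)" using gc t0c by (simp add: group_simps)
      moreover have "f \<in> products G F n" using f(1) ws(2) by (rule products_weaken) simp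
      ultimately show "g \<in> (\<lambda>(f, t). inv t0 \<otimes> (f \<otimes> t)) ` (products G F n \<times> T)"
        using f by (intro image_eqI[of _ _ "(f, t)"]) auto
    qed
    have "card (products G S n) \<le> card (products G F n \<times> T)"
      by (intro surj_card_le[OF _ sub] finite_cartesian_product finite_products F T)
    also have "\<dots> = card (products G F n) * card T" by (rule card_cartesian_product)
    also have "\<dots> \<le> (n + 2) ^ d * (n + 2) ^ card T"
    proof (intro mult_le_mono d)
      have "card T \<le> 2 ^ card T" by (rule less_imp_le) simp
      also have "\<dots> \<le> (n + 2) ^ card T" by (rule power_mono) auto
      finally show "card T \<le> (n + 2) ^ card T" .
    qed
    finally show ?thesis by (simp add: power_add)
  qed
  then show ?thesis by blast
qed

subsection \<open>Density of balls and conjugacy classes\<close>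

text \<open>If the inequality failed at every scale from \<open>s\<close> on, iterating along
  \<open>7 ^ k * s\<close> would give growth by the factor \<open>2 ^ k\<close> beyond what degree
  \<open>d\<close> permits. The ratio 7 is chosen for \<open>infinite_index_density\<close>, where
  radius \<open>6 * r\<close> is enlarged by at most \<open>r\<close>.\<close>

lemma poly_bounded_doubling_scale:
  fixes f :: "nat \<Rightarrow> nat"
  assumes pos: "\<And>n. f n > 0" and bound: "\<And>n. f n \<le> (n + 2) ^ d"
  shows "\<exists>r \<ge> s. f (7 * r) \<le> 2 * 7 ^ d * f r"
proof (rule ccontr)
  assume "\<not> ?thesis"
  then have gt: "2 * 7 ^ d * f r < f (7 * r)" if "r \<ge> s" for r
    using that not_le by blast
  have low: "(2 * 7 ^ d) ^ k \<le> f (7 ^ k * s)" for k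
  proof (induction k)
    case 0
    show ?case using pos[of s] by simp
  next
    case (Suc k)
    have "(2 * 7 ^ d) ^ Suc k \<le> 2 * 7 ^ d * f (7 ^ k * s)" using Suc by simp
    also have "\<dots> \<le> f (7 * (7 ^ k * s))" by (rule less_imp_le, rule gt) simp
    finally show ?case by (simp add: mult.assoc)
  qed
  have "2 ^ k \<le> (s + 2) ^ d" for k
  proof -
    have "(7 ^ d) ^ k * 2 ^ k \<le> f (7 ^ k * s)" using low[of k] by (simp add: power_mult_distrib mult.commute)
    also have "\<dots> \<le> (7 ^ k * s + 2) ^ d" by (rule bound)
    also have "\<dots> \<le> (7 ^ k * (s + 2)) ^ d"
    proof (rule power_mono)
      have "1 \<le> (7 :: nat) ^ k" by simp
      then show "7 ^ k * s + 2 \<le> 7 ^ k * (s + 2)" unfolding add_mult_distrib2 by linarith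
    qed simp
    also have "\<dots> = (7 ^ d) ^ k * (s + 2) ^ d"
      by (simp only: power_mult_distrib power_mult[symmetric] mult.commute[of k])
    finally show ?thesis by simp
  qed
  \<comment> \<open>The exponent \<open>k\<close> is taken equal to the bound itself.\<close>
  then have "2 ^ ((s + 2) ^ d) \<le> (s + 2) ^ d" .
  then show False using less_exp[of "(s + 2) ^ d"] by linarith
qed

context group
begin

lemma card_products_add_le:
  assumes "finite F" "F \<subseteq> carrier G"
  shows "card (products G F (m + n)) \<le> card (products G F m) * card (products G F n)"
proof -
  have "products G F (m + n) \<subseteq> (\<lambda>(g, h). g \<otimes> h) ` (products G F m \<times> products G F n)"
    by (auto elim!: products_split[OF assms(2)])
  then have "card (products G F (m + n)) \<le> card (products G F m \<times> products G F n)"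
    using assms(1) by (intro surj_card_le finite_cartesian_product finite_products)
  then show ?thesis by (simp add: card_cartesian_product)
qed

lemma finite_subset_products:
  assumes "\<And>g. g \<in> carrier G \<Longrightarrow> \<exists>n. g \<in> products G F n" "finite Y" "Y \<subseteq> carrier G"
  shows "\<exists>s. Y \<subseteq> products G F s"
proof -
  have "\<forall>y\<in>Y. \<exists>n. y \<in> products G F n" using assms by blast
  then obtain l where l: "\<forall>y\<in>Y. y \<in> products G F (l y)" by (rule bchoice[THEN exE])
  have "y \<in> products G F (sum l Y)" if "y \<in> Y" for y
    by (rule products_weaken[OF bspec[OF l that]]) (use that assms(2) member_le_sum[of y Y l] in auto)
  then show ?thesis by blast
qed

text \<open>The bound holds at every large radius, although the growth is controlled only at
  infinitely many scales: the ball of radius \<open>n\<close> is covered at a single good scale \<open>r\<close> by disjoint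
  translates \<open>p B(r)\<close> centred in the ball of radius \<open>n - r\<close>.\<close>

lemma infinite_index_density:
  assumes fin: "finite F" and F: "F \<subseteq> carrier G" and sym: "\<And>x. x \<in> F \<Longrightarrow> inv x \<in> F"
    and gen: "\<And>g. g \<in> carrier G \<Longrightarrow> \<exists>n. g \<in> products G F n"
    and growth: "\<And>n. card (products G F n) \<le> (n + 2) ^ d"
    and H: "subgroup H G" and index: "\<not> finite_index H G"
  shows "\<exists>N. \<forall>n\<ge>N. m * card (H \<inter> products G F n) \<le> card (products G F n)"
proof -
  let ?B = "products G F"
  have finB: "finite (?B n)" for n by (rule finite_products[OF fin])
  have BC: "?B n \<subseteq> carrier G" for n by (rule products_closed[OF F])
  \<comment> \<open>\<open>C\<close> is the loss between radii \<open>r\<close> and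
    \<open>7 * r\<close>; taking \<open>C * m\<close> cosets compensates for it and leaves the
    factor \<open>m\<close>.\<close>
  define C :: nat where "C = 2 * 7 ^ d"
  obtain Y where Y: "finite Y" "Y \<subseteq> carrier G" "card Y = C * m"
      and inj: "inj_on (\<lambda>(h, x). h \<otimes> x) (H \<times> Y)"
    by (rule infinite_index_separated[OF H index])
  obtain s where s: "Y \<subseteq> ?B s" using finite_subset_products[OF gen Y(1,2)] by blast
  obtain r where r: "r \<ge> s" "card (?B (7 * r)) \<le> C * card (?B r)"
    using poly_bounded_doubling_scale[of "\<lambda>n. card (?B n)" d s] growth card_products_pos[OF fin]
    unfolding C_def by blast
  \<comment> \<open>The translates of \<open>H \<inter> ?B (6 * r)\<close> by \<open>Y\<close> are
    disjoint and lie in \<open>?B (7 * r)\<close>, since \<open>Y\<close> lies in the ball of radius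
    \<open>s\<close> and \<open>s\<close> is at most \<open>r\<close>.\<close>
  have small: "m * card (H \<inter> ?B (6 * r)) \<le> card (?B r)"
  proof -
    have "(\<lambda>(h, x). h \<otimes> x) ` ((H \<inter> ?B (6 * r)) \<times> Y) \<subseteq> ?B (7 * r)"
    proof clarify
      fix h x assume "h \<in> ?B (6 * r)" "x \<in> Y"
      then have "h \<otimes> x \<in> ?B (6 * r + s)" using s by (intro mult_in_products[OF F]) auto
      then show "h \<otimes> x \<in> ?B (7 * r)" by (rule products_weaken) (use r in auto)
    qed
    then have "card ((H \<inter> ?B (6 * r)) \<times> Y) \<le> card (?B (7 * r))"
      using finB by (intro card_inj_on_le[OF inj_on_subset[OF inj]]) auto
    then have "C * (m * card (H \<inter> ?B (6 * r))) \<le> card (?B (7 * r))"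
      using Y(3) by (simp add: card_cartesian_product mult_ac)
    then have "C * (m * card (H \<inter> ?B (6 * r))) \<le> C * card (?B r)"
      using r(2) by (rule le_trans)
    then show ?thesis by (simp add: C_def)
  qed
  have "m * card (H \<inter> ?B n) \<le> card (?B n)" if n: "n \<ge> r" for n
  proof -
    let ?t = "\<lambda>p R. (\<lambda>b. p \<otimes> b) ` ?B R"
    let ?disj = "pairwise (\<lambda>p q. disjnt (?t p r) (?t q r))"
    \<comment> \<open>Admissible sets of centres; a maximal one both packs the ball of radius
      \<open>n\<close> at scale \<open>r\<close> and covers it at scale
      \<open>3 * r\<close>.\<close>
    define \<P> where "\<P> = {P. P \<subseteq> ?B (n - r) \<and> ?disj P}"
    have fin\<P>: "finite \<P>"
      by (rule finite_subset[of _ "Pow (?B (n - r))"]) (use finB in \<open>auto simp: \<P>_def\<close>)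
    have "{} \<in> \<P>" by (simp add: \<P>_def)
    then have "\<P> \<noteq> {}" by blast
    with fin\<P> have "\<exists>P\<in>\<P>. \<forall>P'\<in>\<P>. P \<subseteq> P' \<longrightarrow> P = P'" by (rule finite_has_maximal)
    then obtain P where "P \<in> \<P>" and max: "\<forall>P'\<in>\<P>. P \<subseteq> P' \<longrightarrow> P = P'" by (rule bexE)
    then have P: "P \<subseteq> ?B (n - r)" "?disj P" by (simp_all add: \<P>_def)
    have finP: "finite P" using P(1) finB finite_subset by blast
    have PC: "p \<in> carrier G" if "p \<in> P" for p using that P(1) BC by blast
    have "card P * card (?B r) = (\<Sum>p\<in>P. card (?t p r))"
    proof -
      have "card (?t p r) = card (?B r)" if "p \<in> P" for p
        using PC[OF that] BC[of r] by (intro card_image inj_onI) (metis l_cancel subsetD)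
      then show ?thesis by simp
    qed
    also have "\<dots> = card (\<Union>p\<in>P. ?t p r)"
      using finP finB P(2) by (intro card_UN_disjoint[symmetric]) (auto simp: pairwise_def disjnt_def)
    also have "\<dots> \<le> card (?B n)"
    proof (rule card_mono[OF finB], clarify)
      fix p b assume "p \<in> P" "b \<in> ?B r"
      then have "p \<otimes> b \<in> ?B ((n - r) + r)" using P(1) by (intro mult_in_products[OF F]) auto
      then show "p \<otimes> b \<in> ?B n" using n by simp
    qed
    finally have packing: "card P * card (?B r) \<le> card (?B n)" .
    \<comment> \<open>Write \<open>h = q b\<close>. By maximality \<open>q ?B(r)\<close> meets some
      \<open>p ?B(r)\<close>, so \<open>q = p a a'^-1\<close> and \<open>h\<close> lies within
      \<open>3 * r\<close> of \<open>p\<close>.\<close>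
    have cover: "H \<inter> ?B n \<subseteq> (\<Union>p\<in>P. H \<inter> ?t p (3 * r))"
    proof
      fix h assume h: "h \<in> H \<inter> ?B n"
      then have "h \<in> ?B ((n - r) + r)" using n by simp
      then obtain q b where q: "q \<in> ?B (n - r)" "b \<in> ?B r" "h = q \<otimes> b"
        by (rule products_split[OF F])
      have "\<exists>p\<in>P. \<not> disjnt (?t p r) (?t q r)"
      proof (rule ccontr)
        assume c: "\<not> ?thesis"
        then have "insert q P \<in> \<P>" using P q by (auto simp: \<P>_def pairwise_insert disjnt_sym)
        then have "P = insert q P" using max by blast
        then have "q \<in> P" by blast
        then have "disjnt (?t q r) (?t q r)" using c by blast
        then show False using one_in_products[of G F r] by (auto simp: disjnt_def)
      qed
      then obtain p where p: "p \<in> P" "\<not> disjnt (?t p r) (?t q r)" by blast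
      then obtain a a' where a: "a \<in> ?B r" "a' \<in> ?B r" "p \<otimes> a = q \<otimes> a'"
        unfolding disjnt_def by blast
      have c: "p \<in> carrier G" "q \<in> carrier G" "a \<in> carrier G" "a' \<in> carrier G" "b \<in> carrier G"
        using p(1) PC a q BC by blast+
      have "q = p \<otimes> a \<otimes> inv a'" using a(3) c by (simp add: m_assoc)
      then have "h = p \<otimes> (a \<otimes> (inv a' \<otimes> b))" using q(3) c by (simp add: m_assoc)
      moreover have "a \<otimes> (inv a' \<otimes> b) \<in> ?B (r + (r + r))"
        using a q sym by (intro mult_in_products[OF F] inv_in_products[OF F]) auto
      ultimately show "h \<in> (\<Union>p\<in>P. H \<inter> ?t p (3 * r))" using h p(1)
        by (auto simp: numeral_3_eq_3 add.assoc)
    qed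
    \<comment> \<open>Dividing by one element \<open>p \<otimes> b0\<close> of the piece moves it
      injectively into \<open>H\<close>, and \<open>b0^-1 b\<close> has length at most
      \<open>6 * r\<close>.\<close>
    have piece: "card (H \<inter> ?t p (3 * r)) \<le> card (H \<inter> ?B (6 * r))" if p: "p \<in> P" for p
    proof (cases "H \<inter> ?t p (3 * r) = {}")
      case False
      then obtain b0 where b0: "b0 \<in> ?B (3 * r)" "p \<otimes> b0 \<in> H" by blast
      have c: "p \<in> carrier G" "b0 \<in> carrier G" using PC[OF p] b0 BC by blast+
      show ?thesis
      proof (rule card_inj_on_le)
        show "inj_on (\<lambda>h. inv (p \<otimes> b0) \<otimes> h) (H \<inter> ?t p (3 * r))"
        proof (rule inj_onI)
          fix h h' assume "h \<in> H \<inter> ?t p (3 * r)" "h' \<in> H \<inter> ?t p (3 * r)"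
            and eq: "inv (p \<otimes> b0) \<otimes> h = inv (p \<otimes> b0) \<otimes> h'"
          then have "h \<in> carrier G" "h' \<in> carrier G" using subgroup.subset[OF H] by blast+
          then show "h = h'" using eq c by simp
        qed
        show "(\<lambda>h. inv (p \<otimes> b0) \<otimes> h) ` (H \<inter> ?t p (3 * r)) \<subseteq> H \<inter> ?B (6 * r)"
        proof (clarify, intro IntI)
          fix b assume b: "b \<in> ?B (3 * r)" "p \<otimes> b \<in> H"
          show "inv (p \<otimes> b0) \<otimes> (p \<otimes> b) \<in> H"
            using b b0 subgroup.m_closed[OF H] subgroup.m_inv_closed[OF H] by blast
          have bc: "b \<in> carrier G" using b BC by blast
          have "inv b0 \<otimes> b \<in> ?B (3 * r + 3 * r)"
            using b b0 sym by (intro mult_in_products[OF F] inv_in_products[OF F]) auto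
          moreover have "inv (p \<otimes> b0) \<otimes> (p \<otimes> b) = inv b0 \<otimes> b"
            using c bc by (simp add: group_simps)
          ultimately show "inv (p \<otimes> b0) \<otimes> (p \<otimes> b) \<in> ?B (6 * r)" by simp
        qed
      qed (use finB in simp)
    qed simp
    have "card (H \<inter> ?B n) \<le> card (\<Union>p\<in>P. H \<inter> ?t p (3 * r))"
      using finP finB by (intro card_mono[OF _ cover]) auto
    also have "\<dots> \<le> (\<Sum>p\<in>P. card (H \<inter> ?t p (3 * r)))" by (rule card_UN_le[OF finP])
    also have "\<dots> \<le> card P * card (H \<inter> ?B (6 * r))"
      using sum_bounded_above[of P "\<lambda>p. card (H \<inter> ?t p (3 * r))"] piece by simp
    finally have "m * card (H \<inter> ?B n) \<le> card P * (m * card (H \<inter> ?B (6 * r)))"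
      by (metis mult.left_commute mult_le_mono2)
    also have "\<dots> \<le> card P * card (?B r)" using small by (rule mult_le_mono2)
    also note packing
    finally show ?thesis .
  qed
  then show ?thesis by blast
qed

text \<open>The cyclic rotations of a word for \<^term>\<open>g\<close> are conjugates of \<^term>\<open>g\<close> lying in the same ball.
  If there are few of them, then each is reached from \<^term>\<open>g\<close> by a short conjugator, and by Schreier's
  argument \<^term>\<open>g\<close> is a product of short elements of its own centralizer.\<close>

lemma few_conjugates_imp_generated_by_short_centralizer:
  assumes F: "F \<subseteq> carrier G" and sym: "\<And>x. x \<in> F \<Longrightarrow> inv x \<in> F" and fin: "finite F"
    and g: "g \<in> products G F n"
    and few: "card (conj_class G g \<inter> products G F n) \<le> M"
  shows "g \<in> generate G {x \<in> products G F (2 * M + 1). g \<otimes> x = x \<otimes> g}"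
proof -
  let ?B = "products G F"
  define L where "L = {x \<in> ?B (2 * M + 1). g \<otimes> x = x \<otimes> g}"
  have BC: "?B n \<subseteq> carrier G" for n by (rule products_closed[OF F])
  have LC: "L \<subseteq> carrier G" using BC by (auto simp: L_def)
  have subL: "subgroup (generate G L) G" using LC by (rule generate_is_subgroup)
  obtain ws where ws: "ws \<in> lists F" "length ws \<le> n" "g = word_prod G ws"
    using g by (rule products_E)
  define p where "p i = word_prod G (take i ws)" for i
  \<comment> \<open>\<open>c i\<close> is the value of the word rotated by \<open>i\<close> letters,
    and \<open>c 0 = g\<close>.\<close>
  define c where "c i = inv (p i) \<otimes> g \<otimes> p i" for i
  have tk: "take i ws \<in> lists F" "drop i ws \<in> lists F" for i
    using ws(1) by (auto dest: in_set_takeD in_set_dropD)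
  have tkC: "take i ws \<in> lists (carrier G)" "drop i ws \<in> lists (carrier G)" for i
    using tk[of i] lists_mono[OF F] by blast+
  have gC: "g \<in> carrier G" using g BC by blast
  have pC: "p i \<in> carrier G" for i unfolding p_def by (rule word_prod_closed[OF tkC(1)])
  have cC: "c i \<in> carrier G" for i using pC gC by (simp add: c_def)
  have wC: "ws ! i \<in> carrier G" if "i < length ws" for i using that ws(1) F by auto
  have p_Suc: "p (Suc i) = p i \<otimes> ws ! i" if "i < length ws" for i
    using that tkC(1)[of i] wC[OF that]
    by (simp add: p_def take_Suc_conv_app_nth word_prod_append del: in_lists_conv_set)
  have c_Suc: "ws ! i \<otimes> c (Suc i) = c i \<otimes> ws ! i" if "i < length ws" for i
    using that wC[OF that] pC gC by (simp add: c_def p_Suc group_simps)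
  have c_in: "c i \<in> conj_class G g \<inter> ?B n" for i
  proof
    show "c i \<in> conj_class G g"
      unfolding conj_class_def c_def by (rule image_eqI[of _ _ "inv (p i)"]) (use pC in auto)
    have "g = p i \<otimes> word_prod G (drop i ws)"
      unfolding p_def ws(3) using tkC[of i] by (simp add: word_prod_append[symmetric] del: in_lists_conv_set)
    then have "c i = word_prod G (drop i ws) \<otimes> p i"
      using pC[of i] word_prod_closed[OF tkC(2)[of i]] by (simp add: c_def group_simps)
    also have "\<dots> = word_prod G (drop i ws @ take i ws)"
      unfolding p_def using tkC[of i] by (simp add: word_prod_append del: in_lists_conv_set)
    finally show "c i \<in> ?B n" using tk[of i] ws(2) by (auto intro!: products_I)
  qed
  \<comment> \<open>The number of distinct rotations met so far; it bounds the conjugator lengths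
    and never exceeds \<open>M\<close>.\<close>
  define D where "D i = card (c ` {..i})" for i
  have D_mono: "D i \<le> D j" if "i \<le> j" for i j
    unfolding D_def using that by (intro card_mono) auto
  have D_le: "D i \<le> M" for i
  proof -
    have "D i \<le> card (conj_class G g \<inter> ?B n)"
      unfolding D_def using c_in finite_products[OF fin] by (intro card_mono) auto
    then show ?thesis using few by simp
  qed
  \<comment> \<open>If \<open>c i\<close> occurred before, the earlier conjugator is reused;
    otherwise one letter is appended, and \<open>D\<close> grows by one as well.\<close>
  have short: "\<exists>t \<in> ?B (D i). g \<otimes> t = t \<otimes> c i" if "i \<le> length ws" for i
    using that
  proof (induction i rule: less_induct)
    case (less i)
    show ?case
    proof (cases i)
      case 0
      then show ?thesis using gC one_in_products[of G F "D i"]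
        by (intro bexI[of _ \<one>]) (auto simp: c_def p_def)
    next
      case (Suc j)
      show ?thesis
      proof (cases "c i \<in> c ` {..j}")
        case True
        then obtain k where k: "k \<le> j" "c i = c k" by blast
        then obtain t where t: "t \<in> ?B (D k)" "g \<otimes> t = t \<otimes> c k"
          using less.IH[of k] less.prems Suc by auto
        moreover have "t \<in> ?B (D i)" using t(1) by (rule products_weaken) (use k Suc D_mono in auto)
        ultimately show ?thesis using k by auto
      next
        case False
        then have D: "D i = D j + 1" unfolding D_def Suc by (simp add: atMost_Suc)
        have j: "j < length ws" using less.prems Suc by simp
        obtain t where t: "t \<in> ?B (D j)" "g \<otimes> t = t \<otimes> c j"
          using less.IH[of j] less.prems Suc by auto
        have tC: "t \<in> carrier G" using t BC by blast
        have "ws ! j \<in> ?B 1" using products_I[of "[ws ! j]" F 1 G] wC[OF j] j ws(1) by auto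
        then have "t \<otimes> ws ! j \<in> ?B (D i)" unfolding D using t by (intro mult_in_products[OF F])
        moreover have "g \<otimes> (t \<otimes> ws ! j) = t \<otimes> ws ! j \<otimes> c i"
        proof -
          have "g \<otimes> (t \<otimes> ws ! j) = t \<otimes> (c j \<otimes> ws ! j)"
            using t(2) tC gC wC[OF j] cC by (simp add: m_assoc[symmetric])
          then show ?thesis using c_Suc[OF j] tC wC[OF j] cC Suc by (simp add: m_assoc)
        qed
        ultimately show ?thesis by blast
      qed
    qed
  qed
  \<comment> \<open>Schreier's argument, with conjugators as representatives: the factor
    \<open>u \<otimes> ws ! i \<otimes> inv t\<close> added in each step commutes with
    \<open>g\<close> and has length at most \<open>M + 1 + M\<close>. The conjugator
    \<open>t\<close> is arbitrary, so that the identity can be used at the end, where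
    \<open>c\<close> returns to \<open>g\<close>.\<close>
  have main: "p i \<otimes> inv t \<in> generate G L"
    if "i \<le> length ws" "t \<in> ?B M" "g \<otimes> t = t \<otimes> c i" for i t
    using that
  proof (induction i arbitrary: t)
    case 0
    have "t \<in> ?B (2 * M + 1)" using 0(2) by (rule products_weaken) auto
    then have "t \<in> L" using 0(3) gC by (auto simp: L_def c_def p_def)
    then have "inv t \<in> generate G L" by (rule generate.inv)
    then show ?case using subgroup.subset[OF subL] by (auto simp: p_def)
  next
    case (Suc i)
    have i: "i < length ws" using Suc.prems by simp
    obtain u where u: "u \<in> ?B (D i)" "g \<otimes> u = u \<otimes> c i" using short[of i] i by auto
    have uM: "u \<in> ?B M" using u(1) D_le by (rule products_weaken) simp
    have C: "u \<in> carrier G" "t \<in> carrier G" using uM Suc.prems(2) BC by blast+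
    let ?w = "ws ! i"
    let ?x = "u \<otimes> ?w \<otimes> inv t"
    have "?w \<in> ?B 1" using products_I[of "[?w]" F 1 G] wC[OF i] i ws(1) by auto
    then have "?x \<in> ?B (M + 1 + M)"
      using uM Suc.prems(2) sym by (intro mult_in_products[OF F] inv_in_products[OF F]) auto
    then have "?x \<in> ?B (2 * M + 1)" by (rule products_weaken) auto
    moreover have "g \<otimes> ?x = ?x \<otimes> g"
    proof -
      have ct: "c (Suc i) = inv t \<otimes> (g \<otimes> t)"
        unfolding Suc.prems(3) using C cC by (simp add: group_simps)
      have "g \<otimes> ?x = (g \<otimes> u) \<otimes> ?w \<otimes> inv t" using C gC wC[OF i] by (simp add: m_assoc)
      also have "\<dots> = u \<otimes> (c i \<otimes> ?w) \<otimes> inv t" using u(2) C cC wC[OF i] by (simp add: m_assoc)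
      also have "\<dots> = u \<otimes> (?w \<otimes> c (Suc i)) \<otimes> inv t" using c_Suc[OF i] by simp
      also have "\<dots> = ?x \<otimes> g" unfolding ct using C gC wC[OF i] by (simp add: group_simps)
      finally show ?thesis .
    qed
    ultimately have "?x \<in> generate G L" by (intro generate.incl) (auto simp: L_def)
    moreover have "p i \<otimes> inv u \<in> generate G L" using Suc.IH[OF _ uM u(2)] i by simp
    moreover have "p (Suc i) \<otimes> inv t = (p i \<otimes> inv u) \<otimes> ?x"
      using C pC wC[OF i] p_Suc[OF i] by (simp add: group_simps)
    ultimately show ?case using subgroup.m_closed[OF subL] by simp
  qed
  have "p (length ws) = g" using ws(3) by (simp add: p_def)
  moreover from this have "c (length ws) = g" using gC by (simp add: c_def)
  ultimately have "g \<otimes> inv \<one> \<in> generate G L"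
    using main[of "length ws" \<one>] gC one_in_products[of G F M] by simp
  then show ?thesis using gC by (simp add: L_def)
qed

section \<open>Centres of generated subgroups\<close>

lemma generate_commute:
  assumes L: "L \<subseteq> carrier G" and x: "x \<in> carrier G" "\<And>l. l \<in> L \<Longrightarrow> x \<otimes> l = l \<otimes> x"
    and y: "y \<in> generate G L"
  shows "x \<otimes> y = y \<otimes> x"
  using y
proof (induction rule: generate.induct)
  case (inv l)
  then have l: "l \<in> carrier G" "x \<otimes> l = l \<otimes> x" using L x by auto
  have "inv l \<otimes> (x \<otimes> l) \<otimes> inv l = inv l \<otimes> x" using l(1) x(1) by (simp add: group_simps)
  moreover have "inv l \<otimes> (l \<otimes> x) \<otimes> inv l = x \<otimes> inv l" using l(1) x(1) by (simp add: group_simps)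
  ultimately show ?case using l(2) by simp
next
  case (eng a b)
  then have "a \<in> carrier G" "b \<in> carrier G" using generate_in_carrier[OF L] by auto
  then show ?case using eng.IH x(1) by (simp add: m_assoc[symmetric]) (simp add: m_assoc)
qed (use x in auto)

text \<open>The centre of the subgroup generated by \<open>L\<close>. It depends on \<open>L\<close>
  alone and not on an element \<open>g\<close>, so that finitely many such subgroups capture all
  elements with few conjugates, at every radius.\<close>

definition generated_center :: "'a set \<Rightarrow> 'a set" where
  "generated_center L = {x \<in> generate G L. \<forall>y \<in> generate G L. x \<otimes> y = y \<otimes> x}"

lemma subgroup_generated_center:
  assumes "L \<subseteq> carrier G" shows "subgroup (generated_center L) G"
proof -
  have sub: "subgroup (generate G L) G" using assms by (rule generate_is_subgroup)
  have C: "x \<in> carrier G" if "x \<in> generate G L" for x using that generate_in_carrier[OF assms] by blast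
  show ?thesis
  proof (rule subgroup.intro)
    show "generated_center L \<subseteq> carrier G" using C by (auto simp: generated_center_def)
    show "\<one> \<in> generated_center L"
      using C subgroup.one_closed[OF sub] by (auto simp: generated_center_def)
  next
    fix x y assume xy: "x \<in> generated_center L" "y \<in> generated_center L"
    have "x \<otimes> y \<otimes> z = z \<otimes> (x \<otimes> y)" if z: "z \<in> generate G L" for z
    proof -
      have c: "x \<in> carrier G" "y \<in> carrier G" "z \<in> carrier G"
        using xy z C by (auto simp: generated_center_def)
      have "x \<otimes> y \<otimes> z = x \<otimes> (y \<otimes> z)" using c by (simp add: m_assoc)
      also have "y \<otimes> z = z \<otimes> y" using xy(2) z by (auto simp: generated_center_def)
      also have "x \<otimes> (z \<otimes> y) = x \<otimes> z \<otimes> y" using c by (simp add: m_assoc)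
      also have "x \<otimes> z = z \<otimes> x" using xy(1) z by (auto simp: generated_center_def)
      finally show ?thesis using c by (simp add: m_assoc)
    qed
    then show "x \<otimes> y \<in> generated_center L"
      using xy subgroup.m_closed[OF sub] unfolding generated_center_def by blast
  next
    fix x assume x: "x \<in> generated_center L"
    have "inv x \<otimes> z = z \<otimes> inv x" if z: "z \<in> generate G L" for z
    proof (rule generate_commute[of "{x}", symmetric])
      show "inv x \<in> generate G {x}" by (rule generate.inv) simp
      show "z \<otimes> l = l \<otimes> z" if "l \<in> {x}" for l
        using that x z unfolding generated_center_def by auto
    qed (use x z C in \<open>auto simp: generated_center_def\<close>)
    then show "inv x \<in> generated_center L"
      using x subgroup.m_inv_closed[OF sub] unfolding generated_center_def by blast
  qed
qed

lemma generated_center_infinite_index: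
  assumes "\<not> virtually_abelian G" "L \<subseteq> carrier G"
  shows "\<not> finite_index (generated_center L) G"
proof -
  have "group (G\<lparr>carrier := generated_center L\<rparr>)"
    by (rule subgroup_imp_group[OF subgroup_generated_center[OF assms(2)]])
  then have "comm_group (G\<lparr>carrier := generated_center L\<rparr>)"
  proof (rule group.group_comm_groupI)
    fix x y assume "x \<in> carrier (G\<lparr>carrier := generated_center L\<rparr>)"
      "y \<in> carrier (G\<lparr>carrier := generated_center L\<rparr>)"
    then have "x \<in> generated_center L" "y \<in> generated_center L" by simp_all
    then have "x \<otimes> y = y \<otimes> x" unfolding generated_center_def by blast
    then show "x \<otimes>\<^bsub>G\<lparr>carrier := generated_center L\<rparr>\<^esub> y = y \<otimes>\<^bsub>G\<lparr>carrier := generated_center L\<rparr>\<^esub> x"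
      by simp
  qed
  then show ?thesis using assms(1) by (auto simp: virtually_abelian_def)
qed

section \<open>Counting conjugacy classes in balls\<close>

lemma large_classes_card:
  assumes "finite B" "B \<subseteq> carrier G"
  shows "M * card (conj_class G ` {g \<in> B. M \<le> card (conj_class G g \<inter> B)}) \<le> card B"
proof -
  let ?Q = "conj_class G ` {g \<in> B. M \<le> card (conj_class G g \<inter> B)}"
  \<comment> \<open>Distinct classes are disjoint, and each one counted occupies at least
    \<open>M\<close> elements of \<open>B\<close>.\<close>
  have "card ?Q * M \<le> (\<Sum>K\<in>?Q. card (K \<inter> B))" by (rule sum_bounded_below[of ?Q M, simplified]) auto
  also have "\<dots> = card (\<Union>K\<in>?Q. K \<inter> B)"
  proof (rule card_UN_disjoint[symmetric], goal_cases)
    case 3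
    show ?case
    proof (intro ballI impI, rule ccontr)
      fix K K' assume K: "K \<in> ?Q" "K' \<in> ?Q" "K \<noteq> K'" "K \<inter> B \<inter> (K' \<inter> B) \<noteq> {}"
      then obtain x where x: "x \<in> K" "x \<in> K'" by blast
      have "K = conj_class G x" "K' = conj_class G x"
        using K(1,2) x assms(2) conj_class_eqI by (auto dest: subsetD)
      then show False using K(3) by simp
    qed
  qed (use assms in auto)
  also have "\<dots> \<le> card B" using assms by (intro card_mono) auto
  finally show ?thesis by (simp add: mult.commute)
qed

lemma not_virtually_abelian_few_classes:
  assumes fin: "finite F" and F: "F \<subseteq> carrier G" and sym: "\<And>x. x \<in> F \<Longrightarrow> inv x \<in> F"
    and gen: "\<And>g. g \<in> carrier G \<Longrightarrow> \<exists>n. g \<in> products G F n"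
    and growth: "\<And>n. card (products G F n) \<le> (n + 2) ^ d"
    and nva: "\<not> virtually_abelian G"
  shows "\<exists>N. \<forall>n\<ge>N. m * card (conj_class G ` products G F n) \<le> card (products G F n)"
proof -
  let ?B = "products G F"
  have finB: "finite (?B n)" for n by (rule finite_products[OF fin])
  have BC: "?B n \<subseteq> carrier G" for n by (rule products_closed[OF F])
  \<comment> \<open>Large classes and the remaining elements each contribute at most a fraction
    \<open>1 / M\<close> of the ball, hence the factor 2.\<close>
  define M where "M = 2 * m"
  define \<L> where "\<L> = Pow (?B (2 * M + 1))"
  have fin\<L>: "finite \<L>" using finB by (simp add: \<L>_def)
  have \<L>C: "L \<subseteq> carrier G" if "L \<in> \<L>" for L using that BC by (auto simp: \<L>_def)
  \<comment> \<open>The density is asked for with the extra factor \<open>card \<L>\<close>, which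
    the union over \<open>\<L>\<close> uses up.\<close>
  have "\<forall>L\<in>\<L>. \<exists>N. \<forall>n\<ge>N. (M * card \<L>) * card (generated_center L \<inter> ?B n) \<le> card (?B n)"
    using \<L>C by (intro ballI infinite_index_density[OF fin F sym gen growth]
      subgroup_generated_center generated_center_infinite_index[OF nva])
  then obtain N where N: "\<forall>L\<in>\<L>. \<forall>n\<ge>N L.
      (M * card \<L>) * card (generated_center L \<inter> ?B n) \<le> card (?B n)"
    by (rule bchoice[THEN exE])
  \<comment> \<open>The sum of the thresholds dominates each of them.\<close>
  have "m * card (conj_class G ` ?B n) \<le> card (?B n)" if n: "n \<ge> sum N \<L>" for n
  proof -
    let ?good = "{g \<in> ?B n. M \<le> card (conj_class G g \<inter> ?B n)}"
    let ?E = "\<Union>L\<in>\<L>. generated_center L \<inter> ?B n"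
    have bad: "g \<in> ?E" if g: "g \<in> ?B n" "g \<notin> ?good" for g
    proof -
      let ?L = "{x \<in> ?B (2 * M + 1). g \<otimes> x = x \<otimes> g}"
      have gC: "g \<in> carrier G" using g BC by blast
      have LC: "?L \<subseteq> carrier G" using BC by blast
      have "g \<in> generate G ?L"
        using g by (intro few_conjugates_imp_generated_by_short_centralizer[OF F sym fin]) auto
      then have "g \<in> generated_center ?L"
        unfolding generated_center_def using generate_commute[OF LC gC] by auto
      moreover have "?L \<in> \<L>" by (auto simp: \<L>_def)
      ultimately show ?thesis using g(1) by blast
    qed
    have "card \<L> * (M * card ?E) = (M * card \<L>) * card ?E" by (simp only: mult_ac)
    also have "\<dots> \<le> (M * card \<L>) * (\<Sum>L\<in>\<L>. card (generated_center L \<inter> ?B n))"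
      by (rule mult_le_mono2[OF card_UN_le[OF fin\<L>]])
    also have "\<dots> = (\<Sum>L\<in>\<L>. (M * card \<L>) * card (generated_center L \<inter> ?B n))"
      by (rule sum_distrib_left)
    also have "\<dots> \<le> (\<Sum>L\<in>\<L>. card (?B n))"
    proof (rule sum_mono)
      fix L assume L: "L \<in> \<L>"
      then have "N L \<le> n" using member_le_sum[of L \<L> N] fin\<L> n by simp
      then show "(M * card \<L>) * card (generated_center L \<inter> ?B n) \<le> card (?B n)" using N L by blast
    qed
    finally have "card \<L> * (M * card ?E) \<le> card \<L> * card (?B n)" by simp
    moreover have "card \<L> > 0" using fin\<L> by (auto simp: card_gt_0_iff \<L>_def)
    ultimately have E: "M * card ?E \<le> card (?B n)" by simp
    have "conj_class G ` ?B n \<subseteq> conj_class G ` ?good \<union> conj_class G ` ?E" using bad by blast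
    moreover have finE: "finite ?E" using fin\<L> finB by auto
    ultimately have "card (conj_class G ` ?B n) \<le> card (conj_class G ` ?good \<union> conj_class G ` ?E)"
      using finB by (intro card_mono) auto
    also have "\<dots> \<le> card (conj_class G ` ?good) + card (conj_class G ` ?E)" by (rule card_Un_le)
    also have "\<dots> \<le> card (conj_class G ` ?good) + card ?E"
      by (rule add_left_mono[OF card_image_le[OF finE]])
    finally have "M * card (conj_class G ` ?B n) \<le> M * (card (conj_class G ` ?good) + card ?E)"
      by (rule mult_le_mono2)
    also have "\<dots> = M * card (conj_class G ` ?good) + M * card ?E" by (rule add_mult_distrib2)
    also have "\<dots> \<le> 2 * card (?B n)" using large_classes_card[OF finB BC, of M n] E by simp
    finally show ?thesis by (simp add: M_def)
  qed
  then show ?thesis by blast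
qed

text \<open>The class of an element of \<open>A\<close> has at most \<open>card T\<close> elements,
  since conjugation only depends on a coset of \<open>A\<close>; and \<open>?B n\<close> is
  contained in \<open>(A \<inter> ?B (n + r)) T\<close>. So the number of classes is at least a
  fixed fraction of the ball.\<close>

lemma virtually_abelian_many_classes:
  assumes fin: "finite F" and F: "F \<subseteq> carrier G" and sym: "\<And>x. x \<in> F \<Longrightarrow> inv x \<in> F"
    and gen: "\<And>g. g \<in> carrier G \<Longrightarrow> \<exists>n. g \<in> products G F n"
    and va: "virtually_abelian G"
  shows "\<exists>m N. \<forall>n\<ge>N. card (products G F n) \<le> m * card (conj_class G ` products G F n)"
proof -
  let ?B = "products G F"
  have finB: "finite (?B n)" for n by (rule finite_products[OF fin])
  have BC: "?B n \<subseteq> carrier G" for n by (rule products_closed[OF F])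
  obtain A where A: "finite_index A G" "comm_group (G\<lparr>carrier := A\<rparr>)"
    using va by (auto simp: virtually_abelian_def)
  have sub: "subgroup A G" using A by (simp add: finite_index_def)
  have AC: "A \<subseteq> carrier G" using sub by (rule subgroup.subset)
  have comm: "a \<otimes> b = b \<otimes> a" if "a \<in> A" "b \<in> A" for a b
    using comm_monoid.m_comm[OF comm_group.axioms(1)[OF A(2)], of a b] that by simp
  obtain T where T: "finite T" "T \<subseteq> carrier G" "\<forall>g \<in> carrier G. \<exists>h\<in>A. \<exists>t\<in>T. g = h \<otimes> t"
    by (rule finite_index_transversal[OF A(1)])
  obtain r where r: "T \<subseteq> ?B r" using finite_subset_products[OF gen T(1,2)] by blast
  have "card (?B (n + r)) \<le> card (?B r) * card T * card T * card (conj_class G ` ?B (n + r))" for n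
  proof -
    have "?B n \<subseteq> (\<lambda>(a, t). a \<otimes> t) ` ((A \<inter> ?B (n + r)) \<times> T)"
    proof
      fix g assume g: "g \<in> ?B n"
      then obtain a t where a: "a \<in> A" "t \<in> T" "g = a \<otimes> t" using T(3) BC by blast
      have C: "a \<in> carrier G" "t \<in> carrier G" using a AC T(2) by auto
      have "g \<otimes> inv t \<in> ?B (n + r)"
        using g a(2) r sym by (intro mult_in_products[OF F] inv_in_products[OF F]) auto
      then have "a \<in> ?B (n + r)" using a(3) C by (simp add: group_simps)
      then show "g \<in> (\<lambda>(a, t). a \<otimes> t) ` ((A \<inter> ?B (n + r)) \<times> T)" using a by force
    qed
    then have "card (?B n) \<le> card ((A \<inter> ?B (n + r)) \<times> T)"
      by (rule surj_card_le[OF finite_cartesian_product[OF finite_Int[OF disjI2[OF finB]] T(1)]])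
    also have "\<dots> = card (A \<inter> ?B (n + r)) * card T" by (rule card_cartesian_product)
    finally have 1: "card (?B n) \<le> card (A \<inter> ?B (n + r)) * card T" .
    let ?Q = "conj_class G ` (A \<inter> ?B (n + r))"
    have class_small: "finite K \<and> card K \<le> card T" if K: "K \<in> ?Q" for K
    proof -
      obtain a where a: "a \<in> A" "K = conj_class G a" using K by blast
      have "conj_class G a \<subseteq> (\<lambda>t. inv t \<otimes> a \<otimes> t) ` T"
      proof
        fix x assume "x \<in> conj_class G a"
        then obtain g where g: "g \<in> carrier G" "x = g \<otimes> a \<otimes> inv g"
          unfolding conj_class_def by blast
        \<comment> \<open>Decomposing \<open>inv g\<close> instead of \<open>g\<close> places
          \<open>b\<close> next to \<open>a\<close>, where the two commute and \<open>b\<close>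
          cancels.\<close>
        obtain b t where b: "b \<in> A" "t \<in> T" "inv g = b \<otimes> t" using T(3) g(1) inv_closed by blast
        have C: "a \<in> carrier G" "b \<in> carrier G" "t \<in> carrier G" using a b AC T(2) by auto
        have "g = inv t \<otimes> inv b" using b(3) g(1) C by (metis inv_inv inv_mult_group)
        then have "x = inv t \<otimes> inv b \<otimes> a \<otimes> (b \<otimes> t)" using g(2) b(3) by simp
        also have "\<dots> = inv t \<otimes> inv b \<otimes> (a \<otimes> b) \<otimes> t" using C by (simp add: m_assoc)
        also have "a \<otimes> b = b \<otimes> a" using a(1) b(1) by (rule comm)
        also have "inv t \<otimes> inv b \<otimes> (b \<otimes> a) \<otimes> t = inv t \<otimes> a \<otimes> t"
          using C by (simp add: group_simps)
        finally show "x \<in> (\<lambda>t. inv t \<otimes> a \<otimes> t) ` T" using b(2) by blast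
      qed
      then show ?thesis using T(1) a(2) by (auto intro: finite_surj surj_card_le)
    qed
    have "A \<inter> ?B (n + r) \<subseteq> \<Union>?Q" using AC conj_class_self by blast
    moreover have "finite (\<Union>?Q)" using class_small finB by blast
    ultimately have "card (A \<inter> ?B (n + r)) \<le> card (\<Union>?Q)" by (rule card_mono[rotated])
    also have "\<dots> \<le> (\<Sum>K\<in>?Q. card K)" using card_UN_le[of ?Q "\<lambda>K. K"] finB by simp
    also have "\<dots> \<le> card ?Q * card T" using sum_bounded_above[of ?Q card "card T"] class_small by simp
    also have "\<dots> \<le> card (conj_class G ` ?B (n + r)) * card T"
      using finB by (intro mult_le_mono1 card_mono) auto
    finally have 2: "card (A \<inter> ?B (n + r)) \<le> card (conj_class G ` ?B (n + r)) * card T" .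
    \<comment> \<open>Submultiplicativity brings both sides to the same radius at the cost of the
      constant \<open>card (?B r)\<close>.\<close>
    have "card (?B (n + r)) \<le> card (?B n) * card (?B r)" by (rule card_products_add_le[OF fin F])
    also have "\<dots> \<le> (card (conj_class G ` ?B (n + r)) * card T * card T) * card (?B r)"
      by (rule mult_le_mono1[OF le_trans[OF 1 mult_le_mono1[OF 2]]])
    finally show ?thesis by (simp add: mult_ac)
  qed
  note bound = this
  show ?thesis
  proof (intro exI allI impI)
    fix n assume "r \<le> n"
    then show "card (?B n) \<le> card (?B r) * card T * card T * card (conj_class G ` ?B n)"
      using bound[of "n - r"] by simp
  qed
qed

end

section \<open>The two implications for the conjugacy ratio\<close>

theorem corollary3p8:
  fixes G :: "('a, 'b) monoid_scheme" and S :: "'a set"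
  assumes "group G"
    and "virtually_nilpotent G"
    and "finite S" and "S \<subseteq> carrier G" and "generate G S = carrier G"
  shows "conj_ratio G S > 0 \<longleftrightarrow> virtually_abelian G"
proof -
  interpret group G by fact
  let ?F = "symm_gens G S"
  let ?B = "products G ?F"
  let ?ratio = "\<lambda>n. real (card (conj_class G ` ?B n)) / real (card (?B n))"
  have fin: "finite ?F" using assms(3) by (simp add: symm_gens_def)
  have F: "?F \<subseteq> carrier G" using assms(4) by (rule symm_gens_closed)
  have sym: "inv\<^bsub>G\<^esub> x \<in> ?F" if "x \<in> ?F" for x using symm_gens_inv[OF assms(4) that] .
  have gen: "\<exists>n. g \<in> ?B n" if "g \<in> carrier G" for g
  proof -
    have "g \<in> generate G S" using that assms(5) by simp
    then show ?thesis using generate_imp_word_prod[OF assms(4)] by (blast intro: products_I)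
  qed
  obtain d where growth: "\<And>n. card (?B n) \<le> (n + 2) ^ d"
    using virtually_nilpotent_growth[OF assms(2) fin F] by blast
  have pos: "real (card (?B n)) > 0" for n using card_products_pos[OF fin] by simp
  have ratio: "conj_ratio G S = limsup (\<lambda>n. ereal (?ratio n))"
    unfolding conj_ratio_def conj_classes_ball_eq[OF assms(4)] word_ball_eq_products[OF assms(4)] ..
  show ?thesis
  proof
    assume "virtually_abelian G"
    then obtain m N where m: "\<And>n. n \<ge> N \<Longrightarrow> card (?B n) \<le> m * card (conj_class G ` ?B n)"
      using virtually_abelian_many_classes[OF fin F sym gen] by blast
    have "m > 0" using m[of N] pos[of N] by (cases m) auto
    have "ereal (1 / real m) \<le> ereal (?ratio n)" if "n \<ge> N" for n
    proof -
      have "real (card (?B n)) \<le> real m * real (card (conj_class G ` ?B n))"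
        using m[OF that] by (simp flip: of_nat_mult)
      then show ?thesis using \<open>m > 0\<close> pos[of n] by (simp add: field_simps)
    qed
    \<comment> \<open>Even the lower limit is bounded away from 0.\<close>
    then have "ereal (1 / real m) \<le> liminf (\<lambda>n. ereal (?ratio n))"
      by (intro Liminf_bounded) (auto simp: eventually_sequentially)
    also have "\<dots> \<le> conj_ratio G S" unfolding ratio by (intro Liminf_le_Limsup) simp
    finally have "ereal (1 / real m) \<le> conj_ratio G S" .
    moreover have "0 < ereal (1 / real m)" using \<open>m > 0\<close> by simp
    ultimately show "conj_ratio G S > 0" by (rule less_le_trans[rotated])
  next
    assume gt: "conj_ratio G S > 0"
    show "virtually_abelian G"
    proof (rule ccontr)
      assume nva: "\<not> virtually_abelian G"
      have le: "conj_ratio G S \<le> ereal (1 / real (Suc k))" for k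
      proof -
        obtain N where N: "\<And>n. n \<ge> N \<Longrightarrow> Suc k * card (conj_class G ` ?B n) \<le> card (?B n)"
          using not_virtually_abelian_few_classes[OF fin F sym gen growth nva] by blast
        have "ereal (?ratio n) \<le> ereal (1 / real (Suc k))" if "n \<ge> N" for n
        proof -
          have "real (Suc k) * real (card (conj_class G ` ?B n)) \<le> real (card (?B n))"
            using N[OF that] by (simp only: of_nat_le_iff flip: of_nat_mult)
          then show ?thesis using pos[of n] by (simp add: field_simps)
        qed
        then show ?thesis unfolding ratio
          by (intro Limsup_bounded) (auto simp: eventually_sequentially)
      qed
      \<comment> \<open>The ratio is an extended real, so a real number below it is chosen before
        comparing with \<open>1 / Suc k\<close>.\<close>
      obtain e where e: "0 < ereal e" "ereal e < conj_ratio G S" using ereal_dense2[OF gt] by auto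
      then obtain k where "1 / real (Suc k) < e" using nat_approx_posE[of e] by auto
      then have "conj_ratio G S < ereal e" using le[of k] by (meson ereal_less_eq(3) le_less_trans less_ereal.simps(1))
      then show False using e(2) by simp
    qed
  qed
qed

end
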